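(* Let $\mathfrak{h}$ be a Lie algebra and let $\vartheta\in\mathfrak{h}^*$ be a closed $1$-form. Let $\rho:\mathfrak{h}\to\mathrm{End}(\mathfrak{h}^* )$ be a Lie algebra representation such that $$\rho(X)(\varphi)(Y)-\rho(Y)(\varphi)(X)=(d^{\mathfrak{h}}_\vartheta\varphi)(X,Y)\qquad\text{for all }X,Y\in\mathfrak{h},\ \varphi\in\mathfrak{h}^*,$$ and let $\alpha\in Z^2(\mathfrak{h},\mathfrak{h}^* )$ be a $2$-cocycle such that $$\alpha(X,Y)(Z)+\alpha(Y,Z)(X)+\alpha(Z,X)(Y)=0\qquad\text{for all }X,Y,Z\in\mathfrak{h}.$$ Then the Lie algebra structure on $\mathfrak{g}=\mathfrak{h}^*\oplus\mathfrak{h}$ attached to $(\mathfrak{h},\rho,[\alpha])$ is a solution of the cotangent extension problem in the locally conformally symplectic context.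
   Context: Lie algebras are real and finite-dimensional; $d^{\mathfrak{h}}$ is the Chevalley–Eilenberg differential of $\mathfrak{h}$ and $d^{\mathfrak{h}}_\vartheta=d^{\mathfrak{h}}-\vartheta\wedge\cdot$. Here $Z^2(\mathfrak{h},\mathfrak{h}^* )$ denotes 2-cocycles of $\mathfrak{h}$ with values in the $\mathfrak{h}$-module $(\mathfrak{h}^*,\rho)$, and $[\alpha]\in H^2(\mathfrak{h},\mathfrak{h}^* )$ the class of $\alpha$. The Lie algebra structure on $\mathfrak{g}=\mathfrak{h}^*\oplus\mathfrak{h}$ attached to $(\mathfrak{h},\rho,[\alpha])$ is: $[(\varphi,0),(\psi,0)]_{\mathfrak{g}}=0$; $[(\varphi,0),(0,X)]_{\mathfrak{g}}=(-\rho(X)(\varphi),0)$; $[(0,X),(0,Y)]_{\mathfrak{g}}=(\alpha(X,Y),[X,Y]_{\mathfrak{h}})$. Extend $\vartheta$ to $\mathfrak{g}$ by $\vartheta(\varphi,X)=\vartheta(X)$, and let $\Omega_0((\varphi,X),(\psi,Y))=\varphi(Y)-\psi(X)$. A solution of the cotangent extension problem in the lcs context is a Lie algebra structure on $\mathfrak{g}$ such that (i) $0\to\mathfrak{h}^*\to\mathfrak{g}\to\mathfrak{h}\to0$ is a short exact sequence of Lie algebras, with $\mathfrak{h}^*$ abelian; (ii) $d\vartheta=0$ and $d\Omega_0=\vartheta\wedge\Omega_0$ on $\mathfrak{g}$. *)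

theory Defs
  imports "HOL-Analysis.Analysis"
begin

section \<open>The algebraic dual of a real vector space\<close>

typedef (overloaded) 'a dual = "{f :: 'a::real_vector \<Rightarrow> real. linear f}"
  morphisms dual_apply Dual
  by (rule exI[of _ "\<lambda>_. 0"]) (simp add: linear_zero)

setup_lifting type_definition_dual

instantiation dual :: (real_vector) real_vector
begin

lift_definition zero_dual :: "'a dual" is "\<lambda>_. 0"
  by (rule linear_zero)

lift_definition plus_dual :: "'a dual \<Rightarrow> 'a dual \<Rightarrow> 'a dual" is "\<lambda>f g x. f x + g x"
  by (rule linear_compose_add)

lift_definition minus_dual :: "'a dual \<Rightarrow> 'a dual \<Rightarrow> 'a dual" is "\<lambda>f g x. f x - g x"
  by (rule linear_compose_sub)

lift_definition uminus_dual :: "'a dual \<Rightarrow> 'a dual" is "\<lambda>f x. - f x"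
  by (rule linear_compose_neg)

lift_definition scaleR_dual :: "real \<Rightarrow> 'a dual \<Rightarrow> 'a dual" is "\<lambda>c f x. c *\<^sub>R f x"
  by (rule linear_compose_scale_right)

instance
  by standard (transfer; simp add: algebra_simps fun_eq_iff)+

end


section \<open>Lie algebras, representations and exact sequences\<close>

text \<open>A Lie algebra is a real vector space type, required to be finite-dimensional, together with a
  bracket on it.\<close>

definition lie_algebra :: "('a::real_vector \<Rightarrow> 'a \<Rightarrow> 'a) \<Rightarrow> bool" where
  "lie_algebra br \<longleftrightarrow>
     (\<exists>B :: 'a set. finite B \<and> span B = UNIV) \<and>
     bilinear br \<and>
     (\<forall>X. br X X = 0) \<and>
     (\<forall>X Y Z. br X (br Y Z) + br Y (br Z X) + br Z (br X Y) = 0)"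

definition lie_hom ::
    "('a::real_vector \<Rightarrow> 'a \<Rightarrow> 'a) \<Rightarrow> ('b::real_vector \<Rightarrow> 'b \<Rightarrow> 'b) \<Rightarrow> ('a \<Rightarrow> 'b) \<Rightarrow> bool" where
  "lie_hom br br' f \<longleftrightarrow> linear f \<and> (\<forall>X Y. f (br X Y) = br' (f X) (f Y))"

definition lie_short_exact ::
    "('a::real_vector \<Rightarrow> 'a \<Rightarrow> 'a) \<Rightarrow> ('a \<Rightarrow> 'b) \<Rightarrow>
     ('b::real_vector \<Rightarrow> 'b \<Rightarrow> 'b) \<Rightarrow> ('b \<Rightarrow> 'c) \<Rightarrow>
     ('c::real_vector \<Rightarrow> 'c \<Rightarrow> 'c) \<Rightarrow> bool" where
  "lie_short_exact brA i brB p brC \<longleftrightarrow>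
     lie_algebra brA \<and> lie_algebra brB \<and> lie_algebra brC \<and>
     lie_hom brA brB i \<and> lie_hom brB brC p \<and>
     inj i \<and> range i = {b. p b = 0} \<and> surj p"

definition lie_rep :: "('a::real_vector \<Rightarrow> 'a \<Rightarrow> 'a) \<Rightarrow> ('a \<Rightarrow> 'v::real_vector \<Rightarrow> 'v) \<Rightarrow> bool" where
  "lie_rep br \<rho> \<longleftrightarrow>
     bilinear \<rho> \<and> (\<forall>X Y v. \<rho> (br X Y) v = \<rho> X (\<rho> Y v) - \<rho> Y (\<rho> X v))"


section \<open>Chevalley--Eilenberg differentials in degrees one and two\<close>

text \<open>Coefficients lie in the module \<open>(V, \<rho>)\<close>. No factorials occur, so that
  \<open>(d \<phi>)(X, Y) = - \<phi> [X, Y]\<close> for scalar one-forms.\<close>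

definition ce_d1 ::
    "('a \<Rightarrow> 'a \<Rightarrow> 'a) \<Rightarrow> ('a \<Rightarrow> 'v \<Rightarrow> 'v) \<Rightarrow> ('a \<Rightarrow> 'v::real_vector) \<Rightarrow> 'a \<Rightarrow> 'a \<Rightarrow> 'v" where
  "ce_d1 br \<rho> \<phi> X Y = \<rho> X (\<phi> Y) - \<rho> Y (\<phi> X) - \<phi> (br X Y)"

definition ce_d2 ::
    "('a \<Rightarrow> 'a \<Rightarrow> 'a) \<Rightarrow> ('a \<Rightarrow> 'v \<Rightarrow> 'v) \<Rightarrow> ('a \<Rightarrow> 'a \<Rightarrow> 'v::real_vector) \<Rightarrow>
     'a \<Rightarrow> 'a \<Rightarrow> 'a \<Rightarrow> 'v" where
  "ce_d2 br \<rho> \<omega> X Y Z =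
     \<rho> X (\<omega> Y Z) - \<rho> Y (\<omega> X Z) + \<rho> Z (\<omega> X Y)
     - \<omega> (br X Y) Z + \<omega> (br X Z) Y - \<omega> (br Y Z) X"

abbreviation trivial_rep :: "'a \<Rightarrow> real \<Rightarrow> real" where
  "trivial_rep \<equiv> (\<lambda>_ _. 0)"

definition cocycle2 ::
    "('a::real_vector \<Rightarrow> 'a \<Rightarrow> 'a) \<Rightarrow> ('a \<Rightarrow> 'v::real_vector \<Rightarrow> 'v) \<Rightarrow> ('a \<Rightarrow> 'a \<Rightarrow> 'v) set" where
  "cocycle2 br \<rho> =
     {\<alpha>. bilinear \<alpha> \<and> (\<forall>X. \<alpha> X X = 0) \<and> (\<forall>X Y Z. ce_d2 br \<rho> \<alpha> X Y Z = 0)}"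

definition wedge11 :: "('a \<Rightarrow> real) \<Rightarrow> ('a \<Rightarrow> real) \<Rightarrow> 'a \<Rightarrow> 'a \<Rightarrow> real" where
  "wedge11 \<theta> \<phi> X Y = \<theta> X * \<phi> Y - \<theta> Y * \<phi> X"

definition wedge12 ::
    "('a \<Rightarrow> real) \<Rightarrow> ('a \<Rightarrow> 'a \<Rightarrow> real) \<Rightarrow> 'a \<Rightarrow> 'a \<Rightarrow> 'a \<Rightarrow> real" where
  "wedge12 \<theta> \<omega> X Y Z = \<theta> X * \<omega> Y Z - \<theta> Y * \<omega> X Z + \<theta> Z * \<omega> X Y"

definition twisted_d1 ::
    "('a \<Rightarrow> 'a \<Rightarrow> 'a) \<Rightarrow> ('a \<Rightarrow> real) \<Rightarrow> ('a \<Rightarrow> real) \<Rightarrow> 'a \<Rightarrow> 'a \<Rightarrow> real" where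
  "twisted_d1 br \<theta> \<phi> X Y = ce_d1 br trivial_rep \<phi> X Y - wedge11 \<theta> \<phi> X Y"


section \<open>The cotangent extension problem\<close>

definition attached_bracket ::
    "('a::real_vector \<Rightarrow> 'a \<Rightarrow> 'a) \<Rightarrow> ('a \<Rightarrow> 'a dual \<Rightarrow> 'a dual) \<Rightarrow> ('a \<Rightarrow> 'a \<Rightarrow> 'a dual) \<Rightarrow>
     'a dual \<times> 'a \<Rightarrow> 'a dual \<times> 'a \<Rightarrow> 'a dual \<times> 'a" where
  "attached_bracket br \<rho> \<alpha> = (\<lambda>(\<phi>, X) (\<psi>, Y). (\<rho> X \<psi> - \<rho> Y \<phi> + \<alpha> X Y, br X Y))"

text \<open>The formula for \<^const>\<open>attached_bracket\<close> is the skew-symmetric bilinear extension of the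
  following three values.\<close>

lemma attached_bracket_values:
  assumes "bilinear br" "lie_rep br \<rho>" "bilinear \<alpha>"
  shows "attached_bracket br \<rho> \<alpha> (\<phi>, 0) (\<psi>, 0) = (0, 0)"
    and "attached_bracket br \<rho> \<alpha> (\<phi>, 0) (0, X) = (- \<rho> X \<phi>, 0)"
    and "attached_bracket br \<rho> \<alpha> (0, X) (0, Y) = (\<alpha> X Y, br X Y)"
  using assms
  by (auto simp: attached_bracket_def lie_rep_def bilinear_lzero bilinear_rzero)

definition extend_form :: "'a::real_vector dual \<Rightarrow> 'a dual \<times> 'a \<Rightarrow> real" where
  "extend_form \<theta> = (\<lambda>(\<phi>, X). dual_apply \<theta> X)"

definition Omega0 :: "'a::real_vector dual \<times> 'a \<Rightarrow> 'a dual \<times> 'a \<Rightarrow> real" where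
  "Omega0 = (\<lambda>(\<phi>, X) (\<psi>, Y). dual_apply \<phi> Y - dual_apply \<psi> X)"

text \<open>The zero bracket on the dual expresses that the kernel of the extension is abelian.\<close>

definition lcs_cotangent_solution ::
    "('a::real_vector \<Rightarrow> 'a \<Rightarrow> 'a) \<Rightarrow> 'a dual \<Rightarrow>
     ('a dual \<times> 'a \<Rightarrow> 'a dual \<times> 'a \<Rightarrow> 'a dual \<times> 'a) \<Rightarrow> bool" where
  "lcs_cotangent_solution br \<theta> brg \<longleftrightarrow>
     lie_algebra brg \<and>
     lie_short_exact (\<lambda>_ _. 0) (\<lambda>\<phi>. (\<phi>, 0)) brg snd br \<and>
     (\<forall>x y. ce_d1 brg trivial_rep (extend_form \<theta>) x y = 0) \<and>
     (\<forall>x y z. ce_d2 brg trivial_rep Omega0 x y z = wedge12 (extend_form \<theta>) Omega0 x y z)"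

end

theory Submission
  imports Defs
begin

text \<open>Each condition on the extension splits by the components of its arguments, and each
  hypothesis kills one piece. In the Jacobi sum for (\<phi>, X), (\<psi>, Y), (\<xi>, Z), the base
  component is the Jacobi identity of \<open>br\<close>; in the dual component the terms in \<phi>,
  \<psi>, \<xi> cancel because \<rho> is a representation, and the rest is the cocycle identity of
  \<alpha> (\<open>lie_algebra_attached_bracket\<close>). The extended one-form is the pullback of a
  closed form along the homomorphism \<open>snd\<close>, hence closed. In the equation for
  \<open>Omega0\<close>, the terms in \<phi>, \<psi>, \<xi> match by the compatibility of \<rho>
  with the twisted differential, and the \<alpha>-terms form minus the cyclic sum assumed to vanish.
  Since \<open>lie_algebra\<close> includes finite dimension, spanning sets of the dual and of the
  product are needed as well.\<close>

lemma finite_spanning_dual: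
  fixes B :: "'a::real_vector set"
  assumes "finite B" "span B = UNIV"
  shows "\<exists>C :: 'a dual set. finite C \<and> span C = UNIV"
proof -
  obtain D where D: "D \<subseteq> B" "independent D" "B \<subseteq> span D"
    using maximal_independent_subset[of B] by auto
  have fin: "finite D" using D(1) assms(1) finite_subset by blast
  have spD: "span D = UNIV"
    using D(3) assms(2) span_mono[of B "span D"] by (simp add: top_unique span_span)
  have lin: "linear (\<lambda>v. representation D v b)" for b
    by (rule linearI) (simp_all add: representation_add representation_scale D(2) spD)
  \<comment> \<open>The coordinate functionals of the basis \<open>D\<close>, that is, its dual
    basis.\<close>
  define e where "e b = Dual (\<lambda>v. representation D v b)" for b
  have e: "dual_apply (e b) v = representation D v b" for b v
    unfolding e_def using lin by (simp add: Dual_inverse)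
  have "f = (\<Sum>b\<in>D. dual_apply f b *\<^sub>R e b)" for f
  proof -
    have f: "linear (dual_apply f)" using dual_apply[of f] by simp
    \<comment> \<open>Sums in \<open>'a dual\<close> are abstract; linearity of evaluation at
      \<open>v\<close> allows computing them pointwise.\<close>
    have ev: "linear (\<lambda>g :: 'a dual. dual_apply g v)" for v
      by (rule linearI) (simp_all add: plus_dual.rep_eq scaleR_dual.rep_eq)
    have "dual_apply f v = dual_apply (\<Sum>b\<in>D. dual_apply f b *\<^sub>R e b) v" for v
    proof -
      have "dual_apply f v = dual_apply f (\<Sum>b\<in>D. representation D v b *\<^sub>R b)"
        using sum_representation_eq[OF D(2) _ fin, of v] spD by simp
      also have "\<dots> = (\<Sum>b\<in>D. representation D v b * dual_apply f b)"
        by (simp add: linear_sum[OF f] linear_scale[OF f])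
      also have "\<dots> = dual_apply (\<Sum>b\<in>D. dual_apply f b *\<^sub>R e b) v"
        by (simp add: linear_sum[OF ev] scaleR_dual.rep_eq e mult.commute)
      finally show ?thesis .
    qed
    then show ?thesis by (intro dual_apply_inject[THEN iffD1] ext)
  qed
  then have "f \<in> span (e ` D)" for f
    using span_sum[of D "\<lambda>b. dual_apply f b *\<^sub>R e b" "e ` D"]
    by (metis (no_types, lifting) imageI span_base span_scale)
  then have "span (e ` D) = UNIV" by blast
  then show ?thesis using fin by blast
qed

lemma finite_spanning_prod:
  fixes B :: "'a::real_vector set" and C :: "'b::real_vector set"
  assumes "finite B" "span B = UNIV" "finite C" "span C = UNIV"
  shows "\<exists>D :: ('a \<times> 'b) set. finite D \<and> span D = UNIV"
proof (intro exI conjI)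
  let ?D = "(\<lambda>x. (x, 0)) ` B \<union> (\<lambda>y. (0, y)) ` C"
  show "finite ?D" using assms by simp
  have "p \<in> span ?D" for p
  proof -
    have l1: "linear (\<lambda>x::'a. (x, 0::'b))" and l2: "linear (\<lambda>y::'b. (0::'a, y))"
      by (auto intro!: linearI)
    have "(fst p, 0) \<in> span ((\<lambda>x. (x, 0::'b)) ` B)"
      using linear_span_image[OF l1, of B] assms(2) by auto
    moreover have "(0, snd p) \<in> span ((\<lambda>y. (0::'a, y)) ` C)"
      using linear_span_image[OF l2, of C] assms(4) by auto
    ultimately have "(fst p, 0) + (0, snd p) \<in> span ?D"
      by (meson span_add span_mono subsetD sup_ge1 sup_ge2)
    then show "p \<in> span ?D" by simp
  qed
  then show "span ?D = UNIV" by blast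
qed

text \<open>Polarization: expand f at the diagonal point X + Y.\<close>

lemma bilinear_alternating_skew:
  assumes "bilinear f" "\<And>X. f X X = 0"
  shows "f X Y = - f Y X"
proof -
  have "f (X + Y) (X + Y) = (f X X + f Y X) + (f X Y + f Y Y)"
    by (simp only: bilinear_ladd[OF assms(1)] bilinear_radd[OF assms(1)])
  then show ?thesis by (simp add: assms(2) eq_neg_iff_add_eq_0 add.commute)
qed

lemma lie_algebra_attached_bracket:
  assumes h: "lie_algebra br" and r: "lie_rep br \<rho>" and a: "\<alpha> \<in> cocycle2 br \<rho>"
  shows "lie_algebra (attached_bracket br \<rho> \<alpha>)"
proof -
  have br: "bilinear br" "\<And>X. br X X = 0"
    "\<And>X Y Z. br X (br Y Z) + br Y (br Z X) + br Z (br X Y) = 0"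
    using h by (auto simp: lie_algebra_def)
  have rho: "bilinear \<rho>" "\<And>X Y v. \<rho> (br X Y) v = \<rho> X (\<rho> Y v) - \<rho> Y (\<rho> X v)"
    using r by (auto simp: lie_rep_def)
  have al: "bilinear \<alpha>" "\<And>X. \<alpha> X X = 0" "\<And>X Y Z. ce_d2 br \<rho> \<alpha> X Y Z = 0"
    using a by (auto simp: cocycle2_def)
  note skew = bilinear_alternating_skew[OF al(1,2)] bilinear_alternating_skew[OF br(1,2)]
  note bil = bilinear_ladd bilinear_radd bilinear_lmul bilinear_rmul bilinear_lsub bilinear_rsub
    bilinear_lneg bilinear_rneg
  have "\<exists>D :: ('a dual \<times> 'a) set. finite D \<and> span D = UNIV"
    using h finite_spanning_dual finite_spanning_prod unfolding lie_algebra_def by metis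
  moreover have "bilinear (attached_bracket br \<rho> \<alpha>)"
    unfolding bilinear_def
    by (auto intro!: linearI simp: attached_bracket_def bil[OF br(1)] bil[OF rho(1)] bil[OF al(1)]
        algebra_simps)
  moreover have "attached_bracket br \<rho> \<alpha> x x = 0" for x
    by (cases x) (simp add: attached_bracket_def br(2) al(2) zero_prod_def)
  moreover have "attached_bracket br \<rho> \<alpha> x (attached_bracket br \<rho> \<alpha> y z)
      + attached_bracket br \<rho> \<alpha> y (attached_bracket br \<rho> \<alpha> z x)
      + attached_bracket br \<rho> \<alpha> z (attached_bracket br \<rho> \<alpha> x y) = 0" for x y z
  proof -
    obtain \<phi> X \<psi> Y \<xi> Z where xyz: "x = (\<phi>, X)" "y = (\<psi>, Y)" "z = (\<xi>, Z)"
      by (metis surj_pair)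
    \<comment> \<open>The cocycle identity in cyclic form. This is exactly the part of the dual
      component of the Jacobi sum that is free of \<phi>, \<psi>, \<xi>; skew-symmetry adjusts the
      order of arguments in \<open>ce_d2\<close>.\<close>
    have "\<rho> X (\<alpha> Y Z) + \<rho> Y (\<alpha> Z X) + \<rho> Z (\<alpha> X Y)
        + \<alpha> X (br Y Z) + \<alpha> Y (br Z X) + \<alpha> Z (br X Y) = 0"
      using al(3)[of X Y Z] skew(1)[of X Z] skew(2)[of X Z] skew(1)[of "br X Y" Z]
        skew(1)[of "br Y Z" X] skew(1)[of "br Z X" Y]
      by (simp add: ce_d2_def bil[OF rho(1)] bil[OF al(1)] algebra_simps)
    \<comment> \<open>What remains is, for \<phi>, the sum \<open>\<rho> Y (\<rho> Z \<phi>) -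
      \<rho> Z (\<rho> Y \<phi>) - \<rho> (br Y Z) \<phi>\<close>, and its analogues for \<psi> and
      \<xi>; all vanish by \<open>rho(2)\<close>.\<close>
    then show ?thesis using br(3)[of X Y Z]
      by (simp add: xyz attached_bracket_def rho(2) bil[OF rho(1)] zero_prod_def algebra_simps)
  qed
  ultimately show ?thesis by (simp add: lie_algebra_def)
qed

text \<open>The base component of the bracket involves only X and Y, so \<open>snd\<close> is a
  homomorphism; two elements of its kernel bracket to zero, so the kernel is the abelian
  dual.\<close>

lemma lie_short_exact_attached_bracket:
  assumes h: "lie_algebra br" and r: "lie_rep br \<rho>" and a: "\<alpha> \<in> cocycle2 br \<rho>"
  shows "lie_short_exact (\<lambda>_ _. 0) (\<lambda>\<phi>. (\<phi>, 0)) (attached_bracket br \<rho> \<alpha>) snd br"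
proof -
  have bil: "bilinear br" "bilinear \<rho>" "bilinear \<alpha>"
    using assms by (auto simp: lie_algebra_def lie_rep_def cocycle2_def)
  have "lie_algebra (\<lambda>_ _. 0 :: 'a dual)"
    using h finite_spanning_dual
    by (auto simp: lie_algebra_def bilinear_def linear_zero)
  moreover have "lie_hom (\<lambda>_ _. 0) (attached_bracket br \<rho> \<alpha>) (\<lambda>\<phi>. (\<phi>, 0))"
    using attached_bracket_values(1)[OF bil(1) r bil(3)]
    by (auto simp: lie_hom_def intro!: linearI)
  moreover have "lie_hom (attached_bracket br \<rho> \<alpha>) br snd"
    by (auto simp: lie_hom_def attached_bracket_def linear_snd split: prod.split)
  ultimately show ?thesis
    using h lie_algebra_attached_bracket[OF assms]
    by (auto simp: lie_short_exact_def inj_on_def)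
qed

theorem corollary1p14:
  fixes br :: "'h::real_vector \<Rightarrow> 'h \<Rightarrow> 'h"
    and \<theta> :: "'h dual"
    and \<rho> :: "'h \<Rightarrow> 'h dual \<Rightarrow> 'h dual"
    and \<alpha> :: "'h \<Rightarrow> 'h \<Rightarrow> 'h dual"
  assumes "lie_algebra br"
    and "\<forall>X Y. ce_d1 br trivial_rep (dual_apply \<theta>) X Y = 0"
    and "lie_rep br \<rho>"
    and "\<forall>X Y \<phi>. dual_apply (\<rho> X \<phi>) Y - dual_apply (\<rho> Y \<phi>) X
           = twisted_d1 br (dual_apply \<theta>) (dual_apply \<phi>) X Y"
    and "\<alpha> \<in> cocycle2 br \<rho>"
    and "\<forall>X Y Z. dual_apply (\<alpha> X Y) Z + dual_apply (\<alpha> Y Z) X + dual_apply (\<alpha> Z X) Y = 0"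
  shows "lcs_cotangent_solution br \<theta> (attached_bracket br \<rho> \<alpha>)"
proof -
  \<comment> \<open>Only base components enter, so this is closedness of \<theta> on the
    base.\<close>
  have "ce_d1 (attached_bracket br \<rho> \<alpha>) trivial_rep (extend_form \<theta>) x y = 0" for x y
    using assms(2) by (auto simp: ce_d1_def attached_bracket_def extend_form_def split: prod.split)
  moreover have "ce_d2 (attached_bracket br \<rho> \<alpha>) trivial_rep Omega0 x y z
      = wedge12 (extend_form \<theta>) Omega0 x y z" for x y z
  proof -
    obtain \<phi> X \<psi> Y \<xi> Z where xyz: "x = (\<phi>, X)" "y = (\<psi>, Y)" "z = (\<xi>, Z)"
      by (metis surj_pair)
    have "bilinear \<alpha>" "\<And>X. \<alpha> X X = 0"
      using assms(5) by (auto simp: cocycle2_def)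
    then have "\<alpha> X Z = - \<alpha> Z X"
      by (rule bilinear_alternating_skew)
    \<comment> \<open>The cyclic hypothesis contains \<open>\<alpha> Z X\<close>, whereas
      \<open>ce_d2\<close> produces \<open>\<alpha> X Z\<close>.\<close>
    then have "dual_apply (\<alpha> Z X) Y = - dual_apply (\<alpha> X Z) Y"
      by (simp add: uminus_dual.rep_eq)
    then show ?thesis
      \<comment> \<open>Each covector is compared separately: \<phi> is paired with Y and Z, \<psi>
        with X and Z, \<xi> with X and Y. The term \<open>- \<phi> [Y, Z]\<close> in the twisted
        differential cancels the one from \<open>Omega0\<close>, leaving the wedge with
        \<theta>.\<close>
      using assms(4)[rule_format, of Y \<phi> Z] assms(4)[rule_format, of X \<psi> Z]
        assms(4)[rule_format, of X \<xi> Y] assms(6)[rule_format, of X Y Z]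
      by (simp add: xyz ce_d2_def wedge12_def attached_bracket_def extend_form_def Omega0_def
          twisted_d1_def ce_d1_def wedge11_def plus_dual.rep_eq minus_dual.rep_eq algebra_simps)
  qed
  ultimately show ?thesis
    using lie_algebra_attached_bracket[OF assms(1,3,5)]
      lie_short_exact_attached_bracket[OF assms(1,3,5)]
    by (simp add: lcs_cotangent_solution_def)
qed

end
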